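(* Let $\Omega\subset\mathbb{R}^n$ be a bounded measurable set with $|\Omega|=1$, and let $f=f(u,\xi)$ and $g=g(u,\xi)$ be arbitrary $C^2$-functions on $\mathbb{R}^2$. Assume that there exist a measurable set $\Omega_1\subset\Omega$ with $|\Omega_1|>0$, a constant $\bar u\in\mathbb{R}$, and a couple $(U,\bar\xi)\in L^\infty(\Omega)\times\mathbb{R}$ satisfying $$f\big(U(x),\bar\xi\big)=0\ \text{ for a.e. }x\in\Omega,\qquad \int_\Omega g\big(U(x),\bar\xi\big)\,dx=0,$$ such that $U(x)=\bar u$ for all $x\in\Omega_1$. If the autocatalysis condition $$f_u(\bar u,\bar\xi)>0$$ holds, then $(U,\bar\xi)$ is an unstable solution (in the Lyapunov sense) of the nonlocal problem $$u_t=f(u,\xi)\quad(x\in\Omega,\ t>0),\qquad \xi_t=\int_\Omega g\big(u(x,t),\xi(t)\big)\,dx\quad(t>0),$$ $$u(x,0)=u_0(x),\qquad \xi(0)=\xi_0.$$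
   Context: For $(u_0,\xi_0)\in L^\infty(\Omega)\times\mathbb{R}$ the nonlocal problem has a unique local-in-time solution $u\in C([0,T],L^\infty(\Omega))$, $\xi\in C([0,T])$, meaning $$u(x,t)=u_0(x)+\int_0^tf(u(x,s),\xi(s))\,ds,\qquad \xi(t)=\xi_0+\int_0^t\int_\Omega g(u(x,s),\xi(s))\,dx\,ds,$$ extended to its maximal existence interval. Stability is understood in the Banach space $X=L^\infty(\Omega)\times\mathbb{R}$ with norm $\|(w,\eta)\|_X=\|w\|_{L^\infty(\Omega)}+|\eta|$: $(U,\bar\xi)$ is Lyapunov stable if for every $\varepsilon>0$ there is $\delta>0$ such that $\|(u_0-U,\xi_0-\bar\xi)\|_X<\delta$ implies that the solution exists for all $t\ge0$ and $\|(u(t)-U,\xi(t)-\bar\xi)\|_X<\varepsilon$ for all $t\ge0$; it is unstable if it is not Lyapunov stable. *)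

theory Defs
  imports "HOL-Analysis.Analysis" "HOL-Probability.Essential_Supremum"
begin

definition C2 :: "('a::real_normed_vector \<Rightarrow> 'b::real_normed_vector) \<Rightarrow> bool" where
  "C2 h \<longleftrightarrow> (\<exists>(h' :: 'a \<Rightarrow> 'a \<Rightarrow>\<^sub>L 'b) (h'' :: 'a \<Rightarrow> 'a \<Rightarrow>\<^sub>L ('a \<Rightarrow>\<^sub>L 'b)).
     (\<forall>p. (h has_derivative blinfun_apply (h' p)) (at p)) \<and>
     (\<forall>p. (h' has_derivative blinfun_apply (h'' p)) (at p)) \<and>
     continuous_on UNIV h'')"

text \<open>
  Elements of the Lebesgue space are represented by functions rather than by classes modulo
  null sets; only their behaviour almost everywhere on \<open>\<Omega>\<close> matters.
\<close>

definition Linfty :: "(real^'n) set \<Rightarrow> (real^'n \<Rightarrow> real) set" where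
  "Linfty \<Omega> = {w. w \<in> borel_measurable (lebesgue_on \<Omega>) \<and>
                   (\<exists>C. AE x in lebesgue_on \<Omega>. \<bar>w x\<bar> \<le> C)}"

definition Linfty_norm :: "(real^'n) set \<Rightarrow> (real^'n \<Rightarrow> real) \<Rightarrow> real" where
  "Linfty_norm \<Omega> w = real_of_ereal (esssup (lebesgue_on \<Omega>) (\<lambda>x. ereal \<bar>w x\<bar>))"

definition X_norm :: "(real^'n) set \<Rightarrow> (real^'n \<Rightarrow> real) \<Rightarrow> real \<Rightarrow> real" where
  "X_norm \<Omega> w \<eta> = Linfty_norm \<Omega> w + \<bar>\<eta>\<bar>"

text \<open>
  Solution on a time interval \<open>J\<close> of the form \<open>{0..T}\<close> or \<open>{0..}\<close>. A curve that is continuous into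
  the Lebesgue space has a representative for which \<open>t \<mapsto> u t x\<close> is continuous for almost
  every \<open>x\<close>; the integral equation is imposed on such a representative, so that the exceptional
  null set does not depend on \<open>t\<close>.
\<close>

definition nonlocal_solution ::
  "(real^'n) set \<Rightarrow> (real \<times> real \<Rightarrow> real) \<Rightarrow> (real \<times> real \<Rightarrow> real) \<Rightarrow>
   (real^'n \<Rightarrow> real) \<Rightarrow> real \<Rightarrow> real set \<Rightarrow> (real \<Rightarrow> real^'n \<Rightarrow> real) \<Rightarrow> (real \<Rightarrow> real) \<Rightarrow> bool" where
  "nonlocal_solution \<Omega> f g u\<^sub>0 \<xi>\<^sub>0 J u \<xi> \<longleftrightarrow>
     (\<forall>t\<in>J. u t \<in> Linfty \<Omega>) \<and>
     (\<forall>t\<in>J. ((\<lambda>s. Linfty_norm \<Omega> (\<lambda>x. u s x - u t x)) \<longlongrightarrow> 0) (at t within J)) \<and>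
     continuous_on J \<xi> \<and>
     (AE x in lebesgue_on \<Omega>. \<forall>t\<in>J.
        (\<lambda>s. f (u s x, \<xi> s)) integrable_on {0..t} \<and>
        u t x = u\<^sub>0 x + integral {0..t} (\<lambda>s. f (u s x, \<xi> s))) \<and>
     (\<forall>t\<in>J.
        (\<lambda>s. LINT x|lebesgue_on \<Omega>. g (u s x, \<xi> s)) integrable_on {0..t} \<and>
        \<xi> t = \<xi>\<^sub>0 + integral {0..t} (\<lambda>s. LINT x|lebesgue_on \<Omega>. g (u s x, \<xi> s)))"

text \<open>
  Solutions being unique, the solution exists for all times and stays close to the steady state
  iff some solution on \<open>{0..}\<close> does.
\<close>

definition Lyapunov_stable ::
  "(real^'n) set \<Rightarrow> (real \<times> real \<Rightarrow> real) \<Rightarrow> (real \<times> real \<Rightarrow> real) \<Rightarrow>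
   (real^'n \<Rightarrow> real) \<Rightarrow> real \<Rightarrow> bool" where
  "Lyapunov_stable \<Omega> f g U \<xi>bar \<longleftrightarrow>
     (\<forall>\<epsilon>>0. \<exists>\<delta>>0. \<forall>u\<^sub>0\<in>Linfty \<Omega>. \<forall>\<xi>\<^sub>0.
        X_norm \<Omega> (\<lambda>x. u\<^sub>0 x - U x) (\<xi>\<^sub>0 - \<xi>bar) < \<delta> \<longrightarrow>
        (\<exists>u \<xi>. nonlocal_solution \<Omega> f g u\<^sub>0 \<xi>\<^sub>0 {0..} u \<xi> \<and>
               (\<forall>t\<ge>0. X_norm \<Omega> (\<lambda>x. u t x - U x) (\<xi> t - \<xi>bar) < \<epsilon>)))"

definition Lyapunov_unstable ::
  "(real^'n) set \<Rightarrow> (real \<times> real \<Rightarrow> real) \<Rightarrow> (real \<times> real \<Rightarrow> real) \<Rightarrow>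
   (real^'n \<Rightarrow> real) \<Rightarrow> real \<Rightarrow> bool" where
  "Lyapunov_unstable \<Omega> f g U \<xi>bar \<longleftrightarrow> \<not> Lyapunov_stable \<Omega> f g U \<xi>bar"

end

theory Submission
  imports Defs
begin

text \<open>
  Perturb \<open>U\<close> by a small multiple of a coordinate function. If the perturbed solution stayed close
  to \<open>(U, \<xi>bar)\<close> forever, then for almost all \<open>x, y\<close> in \<open>\<Omega>\<^sub>1\<close> the functions \<open>t \<mapsto> u t x\<close> and
  \<open>t \<mapsto> u t y\<close> would solve the same scalar equation \<open>v' = f (v, \<xi> t)\<close> in a region where the partial
  derivative of \<open>f\<close> in its first argument is at least some \<open>m > 0\<close>. Their squared difference \<open>z\<close>
  satisfies \<open>z' \<ge> 2 m z\<close>, so it is unbounded unless it vanishes at time \<open>0\<close>; but the coordinate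
  function is not almost everywhere constant on \<open>\<Omega>\<^sub>1\<close>.
\<close>

section \<open>The essential supremum norm and its degenerate values\<close>

lemma AE_abs_le_Linfty_norm:
  assumes "w \<in> Linfty \<Omega>"
  shows "AE x in lebesgue_on \<Omega>. \<bar>w x\<bar> \<le> Linfty_norm \<Omega> w"
proof -
  let ?E = "esssup (lebesgue_on \<Omega>) (\<lambda>x. ereal \<bar>w x\<bar>)"
  obtain C where C: "AE x in lebesgue_on \<Omega>. \<bar>w x\<bar> \<le> C"
    and w [measurable]: "w \<in> borel_measurable (lebesgue_on \<Omega>)"
    using assms unfolding Linfty_def by blast
  have le: "?E \<le> ereal C"
    by (rule esssup_I) (use C in auto)
  have "AE x in lebesgue_on \<Omega>. ereal \<bar>w x\<bar> \<le> ?E"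
    by (rule esssup_AE)
  then show ?thesis
  proof eventually_elim
    \<comment> \<open>\<open>real_of_ereal\<close> sends both infinities to 0, so they must be
      excluded: \<open>le\<close> rules out plus infinity, and the bound at \<open>x\<close> itself
      rules out minus infinity, because an absolute value is nonnegative.\<close>
    case (elim x)
    with le show ?case
      unfolding Linfty_norm_def by (cases ?E) auto
  qed
qed

lemma Linfty_norm_le:
  \<comment> \<open>When \<Omega> is null, the essential supremum is minus infinity and the norm
    becomes 0; this case is covered by \<open>0 \<le> C\<close>.\<close>
  assumes "w \<in> borel_measurable (lebesgue_on \<Omega>)" "0 \<le> C"
    and "AE x in lebesgue_on \<Omega>. \<bar>w x\<bar> \<le> C"
  shows "Linfty_norm \<Omega> w \<le> C"
proof -
  have [measurable]: "w \<in> borel_measurable (lebesgue_on \<Omega>)" by fact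
  let ?E = "esssup (lebesgue_on \<Omega>) (\<lambda>x. ereal \<bar>w x\<bar>)"
  have "?E \<le> ereal C"
    by (rule esssup_I) (use assms in auto)
  then show ?thesis
    unfolding Linfty_norm_def using assms(2) by (cases ?E) auto
qed

lemma Linfty_diff:
  assumes "v \<in> Linfty \<Omega>" "w \<in> Linfty \<Omega>"
  shows "(\<lambda>x. v x - w x) \<in> Linfty \<Omega>"
proof -
  obtain C D where C: "AE x in lebesgue_on \<Omega>. \<bar>v x\<bar> \<le> C" and D: "AE x in lebesgue_on \<Omega>. \<bar>w x\<bar> \<le> D"
    and [measurable]: "v \<in> borel_measurable (lebesgue_on \<Omega>)" "w \<in> borel_measurable (lebesgue_on \<Omega>)"
    using assms unfolding Linfty_def by blast
  have "AE x in lebesgue_on \<Omega>. \<bar>v x - w x\<bar> \<le> C + D"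
    using C D by eventually_elim linarith
  then show ?thesis
    unfolding Linfty_def by auto
qed

lemma Linfty_norm_zero [simp]: "Linfty_norm \<Omega> (\<lambda>x. 0) = 0"
proof (cases "emeasure (lebesgue_on \<Omega>) (space (lebesgue_on \<Omega>)) = 0")
  case True
  then have "esssup (lebesgue_on \<Omega>) (\<lambda>x. ereal \<bar>0\<bar>) = -\<infinity>"
    by (intro esssup_zero_space) auto
  then show ?thesis
    by (simp add: Linfty_norm_def)
next
  case False
  then show ?thesis
    unfolding Linfty_norm_def by (simp add: esssup_const)
qed

text \<open>For a non-measurable \<open>w\<close> or a null \<Omega> the essential supremum is
  infinite and \<open>real_of_ereal\<close> returns 0; otherwise monotonicity compares
  \<open>w\<close> with the zero function. This lets a bound on \<open>X_norm\<close> be split into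
  bounds on its two summands.\<close>

lemma Linfty_norm_nonneg: "0 \<le> Linfty_norm \<Omega> w"
proof (cases "(\<lambda>x. ereal \<bar>w x\<bar>) \<in> borel_measurable (lebesgue_on \<Omega>) \<and>
    emeasure (lebesgue_on \<Omega>) (space (lebesgue_on \<Omega>)) \<noteq> 0")
  case True
  then have "esssup (lebesgue_on \<Omega>) (\<lambda>x. 0 :: ereal) = 0"
    by (simp add: esssup_const)
  moreover have "esssup (lebesgue_on \<Omega>) (\<lambda>x. 0) \<le> esssup (lebesgue_on \<Omega>) (\<lambda>x. ereal \<bar>w x\<bar>)"
    using True by (intro esssup_mono) auto
  ultimately show ?thesis
    unfolding Linfty_norm_def by (simp add: real_of_ereal_pos)
next
  case False
  then have "esssup (lebesgue_on \<Omega>) (\<lambda>x. ereal \<bar>w x\<bar>) \<in> {\<infinity>, -\<infinity>}"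
    using esssup_non_measurable[of "\<lambda>x. ereal \<bar>w x\<bar>" "lebesgue_on \<Omega>"]
      esssup_zero_space[of "lebesgue_on \<Omega>" "\<lambda>x. ereal \<bar>w x\<bar>"]
    by (auto simp: top_ereal_def)
  then show ?thesis
    unfolding Linfty_norm_def by auto
qed

section \<open>The steady state, and scalar equations on the half-line\<close>

lemma nonlocal_solution_steady_state:
  assumes "U \<in> Linfty \<Omega>"
    and "AE x in lebesgue_on \<Omega>. f (U x, \<xi>bar) = 0"
    and "(LINT x|lebesgue_on \<Omega>. g (U x, \<xi>bar)) = 0"
  shows "nonlocal_solution \<Omega> f g U \<xi>bar J (\<lambda>t. U) (\<lambda>t. \<xi>bar)"
  using assms unfolding nonlocal_solution_def by auto

text \<open>A bootstrap: an indefinite integral is continuous, so \<open>v\<close> is continuous,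
  hence so is the integrand, and the fundamental theorem of calculus applies. It serves to turn the
  integral equation at a fixed point of \<Omega> into a differential equation.\<close>

lemma has_real_derivative_of_integral_equation:
  fixes v \<xi> :: "real \<Rightarrow> real" and f :: "real \<times> real \<Rightarrow> real"
  assumes f: "continuous_on UNIV f" and \<xi>: "continuous_on {0..} \<xi>"
    and eq: "\<And>t. 0 \<le> t \<Longrightarrow> (\<lambda>s. f (v s, \<xi> s)) integrable_on {0..t} \<and>
        v t = v\<^sub>0 + integral {0..t} (\<lambda>s. f (v s, \<xi> s))"
  shows "continuous_on {0..} v"
    and "\<And>t. 0 < t \<Longrightarrow> (v has_real_derivative f (v t, \<xi> t)) (at t)"
proof -
  have c: "continuous_on {0..b} v" for b
  proof (cases "0 \<le> b")
    case True
    have "continuous_on {0..b} (\<lambda>t. v\<^sub>0 + integral {0..t} (\<lambda>s. f (v s, \<xi> s)))"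
      using eq[OF True] by (intro continuous_intros indefinite_integral_continuous_1) auto
    then show ?thesis
      by (rule continuous_on_eq) (use eq in auto)
  qed auto
  have fc: "continuous_on {0..b} (\<lambda>s. f (v s, \<xi> s))" for b
    by (rule continuous_on_compose2[OF f])
      (auto intro!: continuous_intros c continuous_on_subset[OF \<xi>])
  have deriv: "(v has_real_derivative f (v t, \<xi> t)) (at t)" if "0 < t" for t
  proof -
    have "((\<lambda>t. v\<^sub>0 + integral {0..t} (\<lambda>s. f (v s, \<xi> s))) has_real_derivative f (v t, \<xi> t))
        (at t within {0..t+1})"
      using that DERIV_add[OF DERIV_const integral_has_real_derivative[OF fc]] by fastforce
    then have "(v has_real_derivative f (v t, \<xi> t)) (at t within {0..t+1})"
      by (rule has_field_derivative_transform_within[OF _ zero_less_one])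
        (use eq that in auto)
    moreover have "at t within {0..t+1} = at t"
      using that by (intro at_within_interior) auto
    ultimately show ?thesis by simp
  qed
  show "\<And>t. 0 < t \<Longrightarrow> (v has_real_derivative f (v t, \<xi> t)) (at t)"
    by (rule deriv)
  show "continuous_on {0..} v"
  proof (unfold continuous_on_eq_continuous_within, intro ballI)
    fix t :: real assume "t \<in> {0..}"
    then have "continuous (at t within {0..t+1}) v"
      using c[of "t+1"] by (simp add: continuous_on_eq_continuous_within)
    moreover have "at t within {0..} = at t within {0..t+1}"
      by (rule at_within_nhd[of _ "{..<t+1}"]) auto
    ultimately show "continuous (at t within {0..}) v" by simp
  qed
qed

text \<open>A lower Gronwall estimate: multiplying by the integrating factor
  \<open>exp (- k * t)\<close> yields a function with nonnegative derivative.\<close>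

lemma exponential_growth:
  fixes z :: "real \<Rightarrow> real"
  assumes c: "continuous_on {0..} z"
    and d: "\<And>t. 0 < t \<Longrightarrow> (z has_real_derivative z' t) (at t)"
    and le: "\<And>t. 0 < t \<Longrightarrow> k * z t \<le> z' t"
    and "0 \<le> t"
  shows "z 0 * exp (k * t) \<le> z t"
proof -
  have "z 0 * exp (- k * 0) \<le> z t * exp (- k * t)"
  proof (rule DERIV_nonneg_imp_increasing_open[where f = "\<lambda>t. z t * exp (- k * t)"])
    show "continuous_on {0..t} (\<lambda>t. z t * exp (- k * t))"
      by (intro continuous_intros continuous_on_subset[OF c]) auto
    fix s assume s: "0 < s" "s < t"
    have "((\<lambda>t. z t * exp (- k * t)) has_real_derivative (z' s - k * z s) * exp (- k * s)) (at s)"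
      by (rule derivative_eq_intros d[OF s(1)] refl | simp add: algebra_simps)+
    then show "\<exists>y. ((\<lambda>t. z t * exp (- k * t)) has_real_derivative y) (at s) \<and> 0 \<le> y"
      using le[OF s(1)] by (intro exI conjI) auto
  qed (use assms in auto)
  then show ?thesis
    by (simp add: exp_minus field_simps)
qed

section \<open>Smoothness of \<open>f\<close> and its growth in the first argument\<close>

lemma C2_imp_continuous_on:
  "C2 h \<Longrightarrow> continuous_on S h"
  unfolding C2_def
  by (metis continuous_at_imp_continuous_on has_derivative_continuous)

text \<open>The partial derivative in the first argument is continuous, so it exceeds some
  \<open>m > 0\<close> on a box around \<open>(a, b)\<close>; there
  \<open>f (v, \<eta>) - m * v\<close> is nondecreasing in \<open>v\<close>. The product form of the
  conclusion is symmetric in \<open>v\<close> and \<open>w\<close>, so it needs no order between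
  them.\<close>

lemma C2_strictly_increasing_near:
  fixes f :: "real \<times> real \<Rightarrow> real"
  assumes "C2 f" and pos: "deriv (\<lambda>v. f (v, b)) a > 0"
  obtains m \<epsilon> where "0 < m" "0 < \<epsilon>"
    and "\<And>v w \<eta>. \<lbrakk>\<bar>v - a\<bar> \<le> \<epsilon>; \<bar>w - a\<bar> \<le> \<epsilon>; \<bar>\<eta> - b\<bar> \<le> \<epsilon>\<rbrakk> \<Longrightarrow>
      m * (v - w)\<^sup>2 \<le> (v - w) * (f (v, \<eta>) - f (w, \<eta>))"
proof -
  obtain h' h'' where h: "\<And>p. (f has_derivative blinfun_apply (h' p)) (at p)"
    and h': "\<And>p. (h' has_derivative blinfun_apply (h'' p)) (at p)"
    using assms(1) unfolding C2_def by blast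
  define D where "D p = blinfun_apply (h' p) (1, 0)" for p
  have D: "((\<lambda>v. f (v, \<eta>)) has_real_derivative D (v, \<eta>)) (at v)" for v \<eta>
  proof -
    have "((\<lambda>v. f (v, \<eta>)) has_derivative (\<lambda>s. blinfun_apply (h' (v, \<eta>)) (s, 0))) (at v)"
      by (rule has_derivative_compose[OF _ h]) (auto intro!: derivative_eq_intros)
    moreover have "blinfun_apply (h' (v, \<eta>)) (s, 0) = D (v, \<eta>) * s" for s
      using blinfun.scaleR_right[of "h' (v, \<eta>)" s "(1, 0)"] by (simp add: D_def)
    ultimately show ?thesis
      by (simp add: has_field_derivative_def)
  qed
  have "continuous_on UNIV h'"
    using h' by (metis continuous_at_imp_continuous_on has_derivative_continuous)
  then have "continuous_on UNIV D"
    unfolding D_def by (intro continuous_intros)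
  \<comment> \<open>Half the value at \<open>(a, b)\<close> makes the inequality strict there, hence
    valid on an open set.\<close>
  moreover define m where "m = D (a, b) / 2"
  moreover have m: "0 < m"
    using pos DERIV_imp_deriv[OF D] by (simp add: m_def)
  ultimately have "open {p. m < D p}" "(a, b) \<in> {p. m < D p}"
    by (auto intro!: open_Collect_less continuous_intros)
  \<comment> \<open>A product neighbourhood allows \<open>v\<close> and \<open>\<eta>\<close> to
    vary independently.\<close>
  then obtain A B where AB: "open A" "open B" "(a, b) \<in> A \<times> B" "A \<times> B \<subseteq> {p. m < D p}"
    by (elim open_prod_elim)
  obtain e1 where e1: "0 < e1" "cball a e1 \<subseteq> A"
    using AB by (auto simp: open_contains_cball)
  obtain e2 where e2: "0 < e2" "cball b e2 \<subseteq> B"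
    using AB by (auto simp: open_contains_cball)
  define \<epsilon> where "\<epsilon> = min e1 e2"
  have less: "m < D (v, \<eta>)" if "\<bar>v - a\<bar> \<le> \<epsilon>" "\<bar>\<eta> - b\<bar> \<le> \<epsilon>" for v \<eta>
  proof -
    have "v \<in> cball a e1" "\<eta> \<in> cball b e2"
      using that by (auto simp: \<epsilon>_def dist_real_def)
    then show ?thesis
      using e1 e2 AB(4) by blast
  qed
  have mono: "f (w, \<eta>) - m * w \<le> f (v, \<eta>) - m * v"
    if "w \<le> v" "\<bar>v - a\<bar> \<le> \<epsilon>" "\<bar>w - a\<bar> \<le> \<epsilon>" "\<bar>\<eta> - b\<bar> \<le> \<epsilon>" for v w \<eta>
  proof (rule DERIV_nonneg_imp_nondecreasing[OF that(1)])
    fix x assume x: "w \<le> x" "x \<le> v"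
    have "((\<lambda>x. f (x, \<eta>) - m * x) has_real_derivative D (x, \<eta>) - m) (at x)"
      by (rule derivative_eq_intros D refl | simp)+
    moreover have "m < D (x, \<eta>)"
      using x that by (intro less) auto
    ultimately show "\<exists>y. ((\<lambda>x. f (x, \<eta>) - m * x) has_real_derivative y) (at x) \<and> 0 \<le> y"
      by (intro exI conjI) auto
  qed
  show thesis
  proof (rule that[OF m])
    show "0 < \<epsilon>" using e1 e2 by (simp add: \<epsilon>_def)
    fix v w \<eta>
    assume *: "\<bar>v - a\<bar> \<le> \<epsilon>" "\<bar>w - a\<bar> \<le> \<epsilon>" "\<bar>\<eta> - b\<bar> \<le> \<epsilon>"
    \<comment> \<open>The two factors have the same sign by \<open>mono\<close>, whichever of
      \<open>v\<close> and \<open>w\<close> is larger.\<close>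
    have "0 \<le> (v - w) * ((f (v, \<eta>) - m * v) - (f (w, \<eta>) - m * w))"
      using mono[of w v \<eta>] mono[of v w \<eta>] * by (cases "w \<le> v") (auto simp: zero_le_mult_iff)
    then show "m * (v - w)\<^sup>2 \<le> (v - w) * (f (v, \<eta>) - f (w, \<eta>))"
      by (simp add: power2_eq_square algebra_simps)
  qed
qed

section \<open>From almost every point to pairs of trajectories\<close>

lemma AE_coordinate_not_constant:
  fixes \<Omega> \<Omega>\<^sub>1 :: "(real^'n) set" and i :: 'n
  assumes "\<Omega> \<in> sets lebesgue" "\<Omega>\<^sub>1 \<subseteq> \<Omega>" "measure lebesgue \<Omega>\<^sub>1 > 0"
    and "AE x in lebesgue_on \<Omega>. P x"
  obtains x y where "x \<in> \<Omega>\<^sub>1" "y \<in> \<Omega>\<^sub>1" "P x" "P y" "x $ i \<noteq> y $ i"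
proof -
  have "\<exists>x\<in>\<Omega>\<^sub>1. \<exists>y\<in>\<Omega>\<^sub>1. P x \<and> P y \<and> x $ i \<noteq> y $ i"
  proof (rule ccontr)
    assume *: "\<not> ?thesis"
    \<comment> \<open>All points of \<open>\<Omega>\<^sub>1\<close> satisfying \<open>P\<close>
      would lie in one hyperplane, so \<open>\<Omega>\<^sub>1\<close> would be covered by a
      hyperplane and the exceptional null set, against its positive measure.\<close>
    obtain c where c: "x $ i = c" if "x \<in> \<Omega>\<^sub>1" "P x" for x
      using * by metis
    have "AE x in lebesgue. x \<in> \<Omega> \<longrightarrow> P x"
      using assms by (simp add: AE_restrict_space_iff)
    then obtain N where N: "N \<in> null_sets lebesgue" "{x. \<not> (x \<in> \<Omega> \<longrightarrow> P x)} \<subseteq> N"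
      by (elim AE_E3) auto
    have "negligible {x :: real^'n. x $ i = c}"
      using negligible_standard_hyperplane[of "axis i (1::real)" c]
      by (simp add: axis_in_Basis_iff inner_axis)
    then have "negligible (N \<union> {x :: real^'n. x $ i = c})"
      using N(1) by (intro negligible_Un) (simp_all add: negligible_iff_null_sets)
    moreover have "\<Omega>\<^sub>1 \<subseteq> N \<union> {x. x $ i = c}"
      using c N(2) assms(2) by blast
    ultimately have "negligible \<Omega>\<^sub>1"
      by (rule negligible_subset)
    then show False
      using assms(3) by (simp add: negligible_imp_measure0)
  qed
  then show thesis
    using that by blast
qed

text \<open>The norm bound gives an exceptional null set for each single time. Countably many such
  sets, one per rational time, have a null union, and continuity in \<open>t\<close> carries the
  bound from rational times to all times.\<close>

lemma AE_close_of_nonlocal_solution: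
  fixes \<Omega> :: "(real^'n) set"
  assumes sol: "nonlocal_solution \<Omega> f g u\<^sub>0 \<xi>\<^sub>0 {0..} u \<xi>"
    and f: "continuous_on UNIV f" and U: "U \<in> Linfty \<Omega>"
    and close: "\<And>t. 0 \<le> t \<Longrightarrow> Linfty_norm \<Omega> (\<lambda>x. u t x - U x) \<le> \<epsilon>"
  shows "AE x in lebesgue_on \<Omega>. \<forall>t\<ge>0. \<bar>u t x - U x\<bar> \<le> \<epsilon>"
proof -
  let ?Q = "{0..} \<inter> \<rat> :: real set"
  have "countable ?Q"
    using countable_rat by blast
  moreover have "AE x in lebesgue_on \<Omega>. \<bar>u t x - U x\<bar> \<le> \<epsilon>" if "t \<in> ?Q" for t
  proof -
    have "u t \<in> Linfty \<Omega>"
      using sol that unfolding nonlocal_solution_def by auto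
    then have "AE x in lebesgue_on \<Omega>. \<bar>u t x - U x\<bar> \<le> Linfty_norm \<Omega> (\<lambda>x. u t x - U x)"
      using U by (intro AE_abs_le_Linfty_norm Linfty_diff)
    then show ?thesis
      using close[of t] that by auto
  qed
  ultimately have "AE x in lebesgue_on \<Omega>. \<forall>t\<in>?Q. \<bar>u t x - U x\<bar> \<le> \<epsilon>"
    by (simp add: AE_ball_countable)
  moreover have "AE x in lebesgue_on \<Omega>. continuous_on {0..} (\<lambda>t. u t x)"
  proof -
    have \<xi>: "continuous_on {0..} \<xi>"
      and "AE x in lebesgue_on \<Omega>. \<forall>t\<in>{0..}. (\<lambda>s. f (u s x, \<xi> s)) integrable_on {0..t} \<and>
        u t x = u\<^sub>0 x + integral {0..t} (\<lambda>s. f (u s x, \<xi> s))"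
      using sol unfolding nonlocal_solution_def by auto
    from this(2) show ?thesis
      by eventually_elim (rule has_real_derivative_of_integral_equation(1)[OF f \<xi>], auto)
  qed
  ultimately show ?thesis
  proof eventually_elim
    case (elim x)
    have "{0..} \<subseteq> closure ?Q"
    proof
      fix t :: real assume "t \<in> {0..}"
      show "t \<in> closure ?Q"
        unfolding closure_approachable
      proof (intro allI impI)
        fix e :: real assume "0 < e"
        \<comment> \<open>Approaching \<open>t\<close> from the right keeps \<open>q\<close>
          nonnegative, even for \<open>t = 0\<close>.\<close>
        then obtain q where "q \<in> \<rat>" "t < q" "q < t + e"
          using Rats_dense_in_real[of t "t + e"] by auto
        then show "\<exists>y\<in>?Q. dist y t < e"
          using \<open>t \<in> {0..}\<close> by (intro bexI[of _ q]) (auto simp: dist_real_def)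
      qed
    qed
    moreover have "closure ?Q \<subseteq> {0..}"
      by (rule closure_minimal) auto
    ultimately have Q: "closure ?Q = {0..}" by blast
    have "\<bar>u t x - U x\<bar> \<le> \<epsilon>" if "t \<in> closure ?Q" for t
    proof (rule continuous_le_on_closure[OF _ that])
      show "continuous_on (closure ?Q) (\<lambda>t. \<bar>u t x - U x\<bar>)"
        unfolding Q by (intro continuous_intros elim)
    qed (use elim in auto)
    then show ?case
      unfolding Q by simp
  qed
qed

text \<open>Squaring avoids tracking which trajectory is larger: the derivative of the squared
  difference is twice the product estimated in \<open>m\<close>. A nonzero initial difference would
  thus outgrow \<open>C\<close>.\<close>

lemma trajectories_coincide:
  fixes v w \<xi> :: "real \<Rightarrow> real"
  assumes cv: "continuous_on {0..} v" and cw: "continuous_on {0..} w"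
    and dv: "\<And>t. 0 < t \<Longrightarrow> (v has_real_derivative f (v t, \<xi> t)) (at t)"
    and dw: "\<And>t. 0 < t \<Longrightarrow> (w has_real_derivative f (w t, \<xi> t)) (at t)"
    and "0 < m"
    and m: "\<And>t. 0 < t \<Longrightarrow> m * (v t - w t)\<^sup>2 \<le> (v t - w t) * (f (v t, \<xi> t) - f (w t, \<xi> t))"
    and bdd: "\<And>t. 0 \<le> t \<Longrightarrow> \<bar>v t - w t\<bar> \<le> C"
  shows "v 0 = w 0"
proof (rule ccontr)
  assume "v 0 \<noteq> w 0"
  define z where "z t = (v t - w t)\<^sup>2" for t
  have "0 < z 0"
    using \<open>v 0 \<noteq> w 0\<close> by (simp add: z_def)
  have grow: "z 0 * exp ((2 * m) * t) \<le> z t" if "0 \<le> t" for t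
  proof (rule exponential_growth[where z' = "\<lambda>t. 2 * ((v t - w t) * (f (v t, \<xi> t) - f (w t, \<xi> t)))"])
    show "continuous_on {0..} z"
      unfolding z_def by (intro continuous_intros cv cw)
    show "(z has_real_derivative 2 * ((v t - w t) * (f (v t, \<xi> t) - f (w t, \<xi> t)))) (at t)"
      if "0 < t" for t
      unfolding z_def
      by (rule derivative_eq_intros dv[OF that] dw[OF that] refl | simp)+
    show "2 * m * z t \<le> 2 * ((v t - w t) * (f (v t, \<xi> t) - f (w t, \<xi> t)))" if "0 < t" for t
      using m[OF that] by (simp add: z_def)
  qed fact
  \<comment> \<open>At this time the linear term of \<open>z 0 * exp (2 * m * t)\<close> alone
    equals the square of \<open>C\<close>, and the exponential is strictly larger than its linear
    term.\<close>
  define t where "t = C\<^sup>2 / (2 * m * z 0)"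
  have "0 \<le> t"
    using \<open>0 < m\<close> \<open>0 < z 0\<close> by (simp add: t_def)
  have "C\<^sup>2 = z 0 * ((2 * m) * t)"
    using \<open>0 < m\<close> \<open>0 < z 0\<close> by (simp add: t_def)
  also have "\<dots> < z 0 * exp ((2 * m) * t)"
    using \<open>0 < z 0\<close> exp_ge_add_one_self[of "2 * m * t"] by (intro mult_strict_left_mono) linarith+
  also have "\<dots> \<le> z t"
    by (rule grow) fact
  also have "z t \<le> C\<^sup>2"
    unfolding z_def using bdd[OF \<open>0 \<le> t\<close>] by (metis abs_ge_zero power2_abs power_mono)
  finally show False by simp
qed

section \<open>Instability by a linear perturbation of the steady state\<close>

theorem theoremB1:
  fixes \<Omega> \<Omega>\<^sub>1 :: "(real^'n) set"
    and f g :: "real \<times> real \<Rightarrow> real"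
    and U :: "real^'n \<Rightarrow> real"
    and ubar \<xi>bar :: real
  assumes "bounded \<Omega>" and "\<Omega> \<in> sets lebesgue" and "measure lebesgue \<Omega> = 1"
    and "C2 f" and "C2 g"
    and "\<Omega>\<^sub>1 \<subseteq> \<Omega>" and "\<Omega>\<^sub>1 \<in> sets lebesgue" and "measure lebesgue \<Omega>\<^sub>1 > 0"
    and "U \<in> Linfty \<Omega>"
    and "AE x in lebesgue_on \<Omega>. f (U x, \<xi>bar) = 0"
    and "(LINT x|lebesgue_on \<Omega>. g (U x, \<xi>bar)) = 0"
    and "\<forall>x\<in>\<Omega>\<^sub>1. U x = ubar"
    and "deriv (\<lambda>v. f (v, \<xi>bar)) ubar > 0"
  shows "nonlocal_solution \<Omega> f g U \<xi>bar {0..} (\<lambda>t. U) (\<lambda>t. \<xi>bar) \<and>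
         Lyapunov_unstable \<Omega> f g U \<xi>bar"
proof
  show "nonlocal_solution \<Omega> f g U \<xi>bar {0..} (\<lambda>t. U) (\<lambda>t. \<xi>bar)"
    using assms by (intro nonlocal_solution_steady_state)
  have f: "continuous_on UNIV f"
    using \<open>C2 f\<close> by (rule C2_imp_continuous_on)
  obtain m \<epsilon> where "0 < m" "0 < \<epsilon>"
    and m: "\<And>v w \<eta>. \<lbrakk>\<bar>v - ubar\<bar> \<le> \<epsilon>; \<bar>w - ubar\<bar> \<le> \<epsilon>; \<bar>\<eta> - \<xi>bar\<bar> \<le> \<epsilon>\<rbrakk> \<Longrightarrow>
      m * (v - w)\<^sup>2 \<le> (v - w) * (f (v, \<eta>) - f (w, \<eta>))"
    using C2_strictly_increasing_near[OF \<open>C2 f\<close> assms(13)] by blast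
  show "Lyapunov_unstable \<Omega> f g U \<xi>bar"
    unfolding Lyapunov_unstable_def
  proof
    assume "Lyapunov_stable \<Omega> f g U \<xi>bar"
    \<comment> \<open>The tolerance demanded of stability is the radius on which the growth estimate
      \<open>m\<close> holds.\<close>
    from this[unfolded Lyapunov_stable_def, rule_format, OF \<open>0 < \<epsilon>\<close>]
    obtain \<delta> where "0 < \<delta>" and \<delta>: "\<And>u\<^sub>0 \<xi>\<^sub>0. \<lbrakk>u\<^sub>0 \<in> Linfty \<Omega>;
        X_norm \<Omega> (\<lambda>x. u\<^sub>0 x - U x) (\<xi>\<^sub>0 - \<xi>bar) < \<delta>\<rbrakk> \<Longrightarrow>
        \<exists>u \<xi>. nonlocal_solution \<Omega> f g u\<^sub>0 \<xi>\<^sub>0 {0..} u \<xi> \<and>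
               (\<forall>t\<ge>0. X_norm \<Omega> (\<lambda>x. u t x - U x) (\<xi> t - \<xi>bar) < \<epsilon>)"
      by blast
    \<comment> \<open>An arbitrary coordinate; index types are nonempty.\<close>
    define i :: 'n where "i = undefined"
    obtain R where "0 < R" and R: "\<And>x. x \<in> \<Omega> \<Longrightarrow> norm x \<le> R"
      using \<open>bounded \<Omega>\<close> by (auto simp: bounded_pos)
    \<comment> \<open>Since coordinates are bounded by \<open>R\<close> on \<Omega>, this factor
      keeps the perturbation within half of \<open>\<delta>\<close>, so that the strict inequality
      required by stability holds.\<close>
    define c where "c = \<delta> / (2 * R)"
    have "0 < c"
      using \<open>0 < \<delta>\<close> \<open>0 < R\<close> by (simp add: c_def)
    \<comment> \<open>The sign is chosen so that \<open>u\<^sub>0\<close>, which is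
      \<open>U x + c * x $ i\<close>, has the form of a difference and \<open>Linfty_diff\<close>
      applies.\<close>
    define p where "p x = - c * x $ i" for x :: "real^'n"
    define u\<^sub>0 where "u\<^sub>0 x = U x - p x" for x
    have "(\<lambda>x :: real^'n. x $ i) \<in> borel_measurable borel"
      by (intro borel_measurable_continuous_onI continuous_intros)
    then have [measurable]: "p \<in> borel_measurable (lebesgue_on \<Omega>)"
      unfolding p_def
      by (intro borel_measurable_times borel_measurable_const measurable_restrict_space1)
        (auto simp: measurable_completion)
    have le: "\<bar>p x\<bar> \<le> \<delta> / 2" if "x \<in> \<Omega>" for x
    proof -
      have "\<bar>p x\<bar> = c * \<bar>x $ i\<bar>"
        using \<open>0 < c\<close> by (simp add: p_def abs_mult)
      also have "\<dots> \<le> c * R"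
        using \<open>0 < c\<close> R[OF that] component_le_norm_cart[of x i] by (intro mult_left_mono) auto
      finally show ?thesis
        using \<open>0 < R\<close> by (simp add: c_def)
    qed
    have p: "AE x in lebesgue_on \<Omega>. \<bar>p x\<bar> \<le> \<delta> / 2"
      by (rule AE_I2) (use le in \<open>simp add: space_restrict_space\<close>)
    then have "p \<in> Linfty \<Omega>"
      unfolding Linfty_def using \<open>p \<in> borel_measurable (lebesgue_on \<Omega>)\<close> by blast
    then have "u\<^sub>0 \<in> Linfty \<Omega>"
      unfolding u\<^sub>0_def by (intro Linfty_diff assms)
    moreover have "X_norm \<Omega> (\<lambda>x. u\<^sub>0 x - U x) (\<xi>bar - \<xi>bar) < \<delta>"
    proof -
      have "Linfty_norm \<Omega> (\<lambda>x. - p x) \<le> \<delta> / 2"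
        using p \<open>0 < \<delta>\<close> by (intro Linfty_norm_le) auto
      then show ?thesis
        using \<open>0 < \<delta>\<close> by (simp add: X_norm_def u\<^sub>0_def)
    qed
    ultimately obtain u \<xi> where sol: "nonlocal_solution \<Omega> f g u\<^sub>0 \<xi>bar {0..} u \<xi>"
      and close: "\<And>t. 0 \<le> t \<Longrightarrow> X_norm \<Omega> (\<lambda>x. u t x - U x) (\<xi> t - \<xi>bar) < \<epsilon>"
      using \<delta> by blast
    have close_u: "Linfty_norm \<Omega> (\<lambda>x. u t x - U x) \<le> \<epsilon>"
      and close_\<xi>: "\<bar>\<xi> t - \<xi>bar\<bar> \<le> \<epsilon>" if "0 \<le> t" for t
      using close[OF that] Linfty_norm_nonneg[of \<Omega> "\<lambda>x. u t x - U x"] by (auto simp: X_norm_def)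
    have \<xi>: "continuous_on {0..} \<xi>"
      and eq: "AE x in lebesgue_on \<Omega>. \<forall>t\<in>{0..}. (\<lambda>s. f (u s x, \<xi> s)) integrable_on {0..t} \<and>
        u t x = u\<^sub>0 x + integral {0..t} (\<lambda>s. f (u s x, \<xi> s))"
      using sol unfolding nonlocal_solution_def by auto
    \<comment> \<open>Both conditions quantify over all times inside one almost-everywhere
      statement, so two individual points can be compared along their whole trajectories.\<close>
    define good where "good x \<longleftrightarrow> (\<forall>t\<ge>0. \<bar>u t x - U x\<bar> \<le> \<epsilon>) \<and>
      (\<forall>t\<in>{0..}. (\<lambda>s. f (u s x, \<xi> s)) integrable_on {0..t} \<and>
        u t x = u\<^sub>0 x + integral {0..t} (\<lambda>s. f (u s x, \<xi> s)))" for x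
    have "AE x in lebesgue_on \<Omega>. \<forall>t\<ge>0. \<bar>u t x - U x\<bar> \<le> \<epsilon>"
      by (rule AE_close_of_nonlocal_solution[OF sol f \<open>U \<in> Linfty \<Omega>\<close> close_u])
    with eq have "AE x in lebesgue_on \<Omega>. good x"
      unfolding good_def by eventually_elim blast
    then obtain x y where xy: "x \<in> \<Omega>\<^sub>1" "y \<in> \<Omega>\<^sub>1" "good x" "good y" "x $ i \<noteq> y $ i"
      using AE_coordinate_not_constant[OF assms(2,6,8)] by metis
    have U: "U x = ubar" "U y = ubar"
      using xy assms(12) by auto
    have near: "\<bar>u t x - ubar\<bar> \<le> \<epsilon>" "\<bar>u t y - ubar\<bar> \<le> \<epsilon>" if "0 \<le> t" for t
      using xy U that unfolding good_def by auto
    have traj: "continuous_on {0..} (\<lambda>t. u t a)"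
      "\<And>t. 0 < t \<Longrightarrow> ((\<lambda>t. u t a) has_real_derivative f (u t a, \<xi> t)) (at t)" if "good a" for a
      using has_real_derivative_of_integral_equation[OF f \<xi>, of "\<lambda>t. u t a" "u\<^sub>0 a"] that
      unfolding good_def by auto
    have "u 0 x = u 0 y"
    proof (rule trajectories_coincide[where C = "2 * \<epsilon>"])
      show "m * (u t x - u t y)\<^sup>2 \<le> (u t x - u t y) * (f (u t x, \<xi> t) - f (u t y, \<xi> t))"
        if "0 < t" for t
        using near[of t] close_\<xi>[of t] that by (intro m) auto
      show "\<bar>u t x - u t y\<bar> \<le> 2 * \<epsilon>" if "0 \<le> t" for t
        using near[OF that] by linarith
    qed (use traj xy \<open>0 < m\<close> in auto)
    \<comment> \<open>The integral over \<open>{0..0}\<close> vanishes. As \<open>U\<close> agrees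
      at \<open>x\<close> and \<open>y\<close>, equal initial values force \<open>p x = p y\<close>,
      hence equal \<open>i\<close>-th coordinates.\<close>
    moreover have "u 0 a = u\<^sub>0 a" if "good a" for a
      using that unfolding good_def by auto
    ultimately have "p x = p y"
      using xy U by (simp add: u\<^sub>0_def)
    then show False
      using xy(5) \<open>0 < c\<close> by (simp add: p_def)
  qed
qed

end
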